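(* Let $\hat N\ge1$, $\hat{\mathcal N}=\{1,\dots,\hat N\}$, $\alpha\ge2$, $h>0$, $\kappa>0$, $\tilde P_{c}>0$, and let $\tilde r_1,\dots,\tilde r_{\hat N}>0$ with $\tilde r_{\max}=\max_i\tilde r_i$ and $\tilde r_{\min}=\min_i\tilde r_i$. Let $\boldsymbol{A}_t\subseteq\mathbb{R}^2$ be the task area. For every location vector $\boldsymbol{L}=(L_1,\dots,L_{\hat N})$ with $L_i=(x_i,y_i)\in\boldsymbol{A}_t$, the median mechanism $\mathsf{M}_{\mathrm{MED}}$ satisfies $$\hat l_m(\mathsf{M}_{\mathrm{MED}}(\boldsymbol{L}))\le 2^{\frac{\alpha}{2}}\,\hat N^{\frac{\alpha}{2}-1}\,\frac{\tilde r_{\max}}{\tilde r_{\min}}\;\hat l_m(\mathsf{M}_{\mathrm{OPT}}(\boldsymbol{L})),$$ i.e. the median mechanism has approximation ratio $2^{\alpha/2}\hat N^{\alpha/2-1}\tilde r_{\max}/\tilde r_{\min}$ for minimizing the platform's crowdsourcing cost $\hat l_m$.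
   Context: There are $\hat N$ employed workers at locations $L_i=(x_i,y_i)$ with fixed transmission rates $\tilde r_i>0$. For a base station location $L_{\mathrm M}=(x_{\mathrm M},y_{\mathrm M})$ at height $h$, the distance to worker $i$ is $d_i(L_i,L_{\mathrm M})=\sqrt{(x_i-x_{\mathrm M})^2+(y_i-y_{\mathrm M})^2+h^2}$. The platform's crowdsourcing cost (for given $\boldsymbol{L}$) is $$\hat l_m(L_{\mathrm M})=\sum_{i\in\hat{\mathcal N}}\frac{\tilde r_i}{\sum_{j\in\hat{\mathcal N}}\tilde r_j}\,\tilde P_c\,\kappa\, d_i(L_i,L_{\mathrm M})^{\alpha}.$$ The median mechanism $\mathsf{M}_{\mathrm{MED}}(\boldsymbol{L})=(x_{\mathrm M},y_{\mathrm M})$ is computed coordinatewise: sort the $x$-coordinates in ascending order $x_{(1)}\le\dots\le x_{(\hat N)}$ and put $x_{\mathrm M}=x_{((\hat N+1)/2)}$ if $\hat N$ is odd and $x_{\mathrm M}=\tfrac12(x_{(\hat N/2)}+x_{(\hat N/2+1)})$ if $\hat N$ is even; $y_{\mathrm M}$ is obtained in the same way from the $y$-coordinates (sorted separately). $\mathsf{M}_{\mathrm{OPT}}(\boldsymbol{L})$ is a minimizer of $\hat l_m$ over $\boldsymbol{A}_t$ (assumed to exist), ignoring incentive constraints. *)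

theory Defs
  imports Complex_Main
begin

type_synonym location = "real \<times> real"

definition station_dist :: "real \<Rightarrow> location \<Rightarrow> location \<Rightarrow> real" where
  "station_dist h p q = sqrt ((fst p - fst q)\<^sup>2 + (snd p - snd q)\<^sup>2 + h\<^sup>2)"

(* Workers are numbered 1, ..., N: values of L and r outside {1..N} are never used. *)

definition crowdsourcing_cost ::
  "nat \<Rightarrow> (nat \<Rightarrow> real) \<Rightarrow> real \<Rightarrow> real \<Rightarrow> real \<Rightarrow> real \<Rightarrow> (nat \<Rightarrow> location) \<Rightarrow> location \<Rightarrow> real" where
  "crowdsourcing_cost N r P \<kappa> h \<alpha> L q =
     (\<Sum>i\<in>{1..N}. r i / (\<Sum>j\<in>{1..N}. r j) * P * \<kappa> * station_dist h (L i) q powr \<alpha>)"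

(* The k-th smallest of x 1, ..., x N, counted with multiplicity; meaningful for 1 <= k <= N. *)
definition order_statistic :: "nat \<Rightarrow> (nat \<Rightarrow> real) \<Rightarrow> nat \<Rightarrow> real" where
  "order_statistic N x k = sort (map x [1..<N + 1]) ! (k - 1)"

definition median :: "nat \<Rightarrow> (nat \<Rightarrow> real) \<Rightarrow> real" where
  "median N x =
     (if odd N then order_statistic N x ((N + 1) div 2)
      else 1 / 2 * (order_statistic N x (N div 2) + order_statistic N x (N div 2 + 1)))"

definition median_mechanism :: "nat \<Rightarrow> (nat \<Rightarrow> location) \<Rightarrow> location" where
  "median_mechanism N L = (median N (\<lambda>i. fst (L i)), median N (\<lambda>i. snd (L i)))"

end

(* Write p = \<alpha>/2 and let D i be the squared distances, so that the cost is a weighted sum of D i powr p.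
   The ratio of the weights costs a factor r_max / r_min. Superadditivity of t powr p at the median,
   and the power mean inequality at the competitor, reduce the claim to p = 1, i.e. to showing that
   the median at most doubles the sum of squared deviations in each coordinate. For this, pair the
   i-th smallest value a with the i-th largest value b: the median m lies between them, hence
   (a - m)^2 + (b - m)^2 <= (a - b)^2 <= 2 ((a - q)^2 + (b - q)^2) for every q. *)
theory Submission
  imports Defs "HOL-Analysis.Convex" "HOL-Library.Multiset"
begin

text \<open>Sorting only permutes the multiset of values. Reindexing by rank is what allows opposite
  ranks to be paired below.\<close>

lemma sum_eq_sum_order_statistic:
  fixes f :: "real \<Rightarrow> real"
  shows "(\<Sum>i\<in>{1..N}. f (x i)) = (\<Sum>i<N. f (order_statistic N x (Suc i)))"
proof -
  let ?s = "sort (map x [1..<N + 1])"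
  have "(\<Sum>i\<in>{1..N}. f (x i)) = sum_list (map f (map x [1..<N + 1]))"
    by (simp add: interv_sum_list_conv_sum_set_nat comp_def atLeastLessThanSuc_atLeastAtMost del: upt_Suc)
  also have "\<dots> = sum_list (map f ?s)"
    by (metis mset_map mset_sort sum_mset_sum_list)
  also have "\<dots> = (\<Sum>i<N. f (?s ! i))"
    by (simp add: sum_list_sum_nth atLeast0LessThan del: upt_Suc)
  finally show ?thesis
    by (simp add: order_statistic_def del: upt_Suc)
qed

lemma order_statistic_mono:
  assumes "i \<le> j" "1 \<le> j" "j \<le> N"
  shows "order_statistic N x i \<le> order_statistic N x j"
  unfolding order_statistic_def using assms
  by (intro sorted_nth_mono) (auto simp del: upt_Suc)

text \<open>Ranks with i + j = N + 1 are mirror images about the middle, so every rank entering the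
  median lies between them.\<close>

lemma median_between:
  assumes "1 \<le> i" "i \<le> j" "i + j = N + 1"
  shows "order_statistic N x i \<le> median N x" "median N x \<le> order_statistic N x j"
proof -
  have "order_statistic N x i \<le> median N x \<and> median N x \<le> order_statistic N x j"
  proof (cases "odd N")
    case True
    with assms have "i \<le> (N + 1) div 2" "(N + 1) div 2 \<le> j" "1 \<le> j" "j \<le> N"
      by presburger+
    then show ?thesis
      using True by (simp add: median_def order_statistic_mono)
  next
    case False
    \<comment> \<open>For even N the sum i + j is odd, so i < j and both middle ranks fit between i
      and j.\<close>
    with assms have *: "i \<le> N div 2" "N div 2 + 1 \<le> j" "1 \<le> N div 2" "j \<le> N"
      by presburger+
    then have "order_statistic N x i \<le> order_statistic N x (N div 2)"
      "order_statistic N x (N div 2) \<le> order_statistic N x (N div 2 + 1)"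
      "order_statistic N x (N div 2 + 1) \<le> order_statistic N x j"
      by (intro order_statistic_mono; linarith)+
    then show ?thesis
      using False by (simp add: median_def)
  qed
  then show "order_statistic N x i \<le> median N x" "median N x \<le> order_statistic N x j"
    by auto
qed

lemma sum_squares_median_le:
  "(\<Sum>i\<in>{1..N}. (x i - median N x)\<^sup>2) \<le> 2 * (\<Sum>i\<in>{1..N}. (x i - q)\<^sup>2)"
proof -
  define s where "s i = order_statistic N x (Suc i)" for i
  define m where "m = median N x"
  have pair: "(s i - m)\<^sup>2 + (s (N - Suc i) - m)\<^sup>2 \<le> 2 * ((s i - q)\<^sup>2 + (s (N - Suc i) - q)\<^sup>2)"
    if "i < N" for i
  proof -
    let ?a = "s i" and ?b = "s (N - Suc i)"
    \<comment> \<open>The ranks \<open>Suc i\<close> and \<open>Suc (N - Suc i)\<close> add up to N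
      + 1. As i runs through all indices, either one can be the smaller.\<close>
    have "?a \<le> m \<and> m \<le> ?b \<or> ?b \<le> m \<and> m \<le> ?a"
      using median_between[of "Suc i" "Suc (N - Suc i)" N x]
        median_between[of "Suc (N - Suc i)" "Suc i" N x] that
      unfolding s_def m_def by (cases "Suc i \<le> Suc (N - Suc i)") auto
    then have "(?a - m) * (?b - m) \<le> 0"
      by (auto simp: mult_le_0_iff)
    \<comment> \<open>The right side of the goal minus its left side equals (a + b - 2 q)^2 - 2 (a -
      m) (b - m).\<close>
    moreover have "0 \<le> ((?a - q) + (?b - q))\<^sup>2"
      by simp
    ultimately show ?thesis
      by (simp add: power2_eq_square algebra_simps)
  qed
  \<comment> \<open>Reflecting the index counts every term twice; for odd N the middle value is
    paired with itself, so no case split on parity is needed.\<close>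
  have double: "(\<Sum>i<N. (s i - c)\<^sup>2 + (s (N - Suc i) - c)\<^sup>2) = 2 * (\<Sum>i<N. (s i - c)\<^sup>2)" for c
    using sum.nat_diff_reindex[of "\<lambda>i. (s i - c)\<^sup>2" N] by (simp add: sum.distrib)
  have "2 * (\<Sum>i<N. (s i - m)\<^sup>2) \<le> 2 * (2 * (\<Sum>i<N. (s i - q)\<^sup>2))"
    \<comment> \<open>Distributivity is instantiated at paired sums so that it cannot fire on the
      unpaired sum before \<open>double\<close> rewrites it.\<close>
    unfolding double[symmetric] sum_distrib_left[of 2 "\<lambda>i. (s i - q)\<^sup>2 + _ i"]
    by (intro sum_mono pair) simp
  then show ?thesis
    using sum_eq_sum_order_statistic[where f = "\<lambda>t. (t - m)\<^sup>2" and N = N and x = x]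
      sum_eq_sum_order_statistic[where f = "\<lambda>t. (t - q)\<^sup>2" and N = N and x = x]
    by (simp add: s_def m_def)
qed

text \<open>Split off one factor, t^p = t * t^(p-1), and bound t^(p-1) by the same power of the
  whole sum, using p - 1 \<ge> 0.\<close>

lemma sum_powr_le_powr_sum:
  fixes f :: "'a \<Rightarrow> real"
  assumes "finite S" "1 \<le> p" "\<And>i. i \<in> S \<Longrightarrow> 0 \<le> f i"
  shows "(\<Sum>i\<in>S. f i powr p) \<le> (\<Sum>i\<in>S. f i) powr p"
proof -
  have split: "t powr p = t * t powr (p - 1)" if "0 \<le> t" for t :: real
    using powr_add[of t 1 "p - 1"] that by simp
  have "(\<Sum>i\<in>S. f i powr p) = (\<Sum>i\<in>S. f i * f i powr (p - 1))"
    using assms(3) by (intro sum.cong refl split) auto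
  also have "\<dots> \<le> (\<Sum>i\<in>S. f i * (\<Sum>i\<in>S. f i) powr (p - 1))"
    using assms by (intro sum_mono mult_left_mono powr_mono2 member_le_sum) auto
  also have "\<dots> = (\<Sum>i\<in>S. f i) powr p"
    using assms(3) by (simp add: split sum_nonneg sum_distrib_right)
  finally show ?thesis .
qed

text \<open>Jensen's inequality for the convex function t^p with equal weights 1/n, multiplied by
  n^p.\<close>

lemma powr_sum_le_sum_powr:
  fixes f :: "'a \<Rightarrow> real"
  assumes "finite S" "1 \<le> p" "\<And>i. i \<in> S \<Longrightarrow> 0 < f i"
  shows "(\<Sum>i\<in>S. f i) powr p \<le> real (card S) powr (p - 1) * (\<Sum>i\<in>S. f i powr p)"
proof (cases "S = {}")
  case False
  define n where "n = real (card S)"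
  have n: "n > 0"
    using False assms(1) by (simp add: n_def card_gt_0_iff)
  have "(\<Sum>i\<in>S. (1 / n) *\<^sub>R f i) powr p \<le> (\<Sum>i\<in>S. 1 / n * f i powr p)"
    using assms False n
    by (intro convex_on_sum[OF _ _ powr_convex]) (auto simp: n_def)
  then have "((\<Sum>i\<in>S. f i) / n) powr p \<le> (\<Sum>i\<in>S. f i powr p) / n"
    by (simp add: sum_divide_distrib)
  then have "(\<Sum>i\<in>S. f i) powr p / n powr p \<le> (\<Sum>i\<in>S. f i powr p) / n"
    by (simp add: powr_divide)
  then show ?thesis
    using n unfolding n_def[symmetric] by (simp add: powr_diff field_simps)
qed simp

lemma station_dist_powr:
  "station_dist h p q powr \<alpha> = (station_dist h p q)\<^sup>2 powr (\<alpha> / 2)"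
proof -
  have "0 \<le> station_dist h p q"
    by (simp add: station_dist_def)
  then show ?thesis
    by (simp add: powr_half_sqrt_powr powr_powr flip: powr_numeral)
qed

lemma sum_station_dist_median_le:
  "(\<Sum>i\<in>{1..N}. (station_dist h (L i) (median_mechanism N L))\<^sup>2)
    \<le> 2 * (\<Sum>i\<in>{1..N}. (station_dist h (L i) q)\<^sup>2)"
proof -
  \<comment> \<open>The height adds N h^2 on the left and twice that on the right, so it only leaves
    slack in the planar estimate.\<close>
  have "0 \<le> real N * h\<^sup>2"
    by simp
  then show ?thesis
    using sum_squares_median_le[of "\<lambda>i. fst (L i)" N "fst q"]
      sum_squares_median_le[of "\<lambda>i. snd (L i)" N "snd q"]
    by (simp add: station_dist_def median_mechanism_def sum.distrib distrib_left)
      (use \<open>0 \<le> real N * h\<^sup>2\<close> in linarith)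
qed

lemma sum_station_dist_powr_median_le:
  assumes "\<alpha> \<ge> 2" "h > 0"
  shows "(\<Sum>i\<in>{1..N}. station_dist h (L i) (median_mechanism N L) powr \<alpha>)
    \<le> 2 powr (\<alpha> / 2) * real N powr (\<alpha> / 2 - 1) * (\<Sum>i\<in>{1..N}. station_dist h (L i) q powr \<alpha>)"
proof -
  define D where "D q i = (station_dist h (L i) q)\<^sup>2" for q i
  \<comment> \<open>The height h > 0 keeps squared distances strictly positive, as required by
    \<open>powr_sum_le_sum_powr\<close>.\<close>
  have D: "D q i > 0" for q i
    using assms(2) by (simp add: D_def station_dist_def add_nonneg_pos)
  have "(\<Sum>i\<in>{1..N}. D (median_mechanism N L) i powr (\<alpha> / 2))
      \<le> (\<Sum>i\<in>{1..N}. D (median_mechanism N L) i) powr (\<alpha> / 2)"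
    using assms(1) by (intro sum_powr_le_powr_sum) (auto simp: D_def)
  also have "\<dots> \<le> (2 * (\<Sum>i\<in>{1..N}. D q i)) powr (\<alpha> / 2)"
    using assms(1) sum_station_dist_median_le[of h L N q]
    by (intro powr_mono2) (auto simp: D_def sum_nonneg)
  also have "\<dots> = 2 powr (\<alpha> / 2) * (\<Sum>i\<in>{1..N}. D q i) powr (\<alpha> / 2)"
    by (simp add: powr_mult)
  also have "\<dots> \<le> 2 powr (\<alpha> / 2)
      * (real (card {1..N}) powr (\<alpha> / 2 - 1) * (\<Sum>i\<in>{1..N}. D q i powr (\<alpha> / 2)))"
    using assms(1) D by (intro mult_left_mono powr_sum_le_sum_powr) auto
  finally show ?thesis
    unfolding station_dist_powr[where \<alpha> = \<alpha>] D_def by (simp add: mult.assoc)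
qed

theorem proposition2:
  fixes N :: nat and \<alpha> h \<kappa> P :: real
    and r :: "nat \<Rightarrow> real" and r_max r_min :: real
    and A :: "location set" and L :: "nat \<Rightarrow> location"
    and M_OPT :: "(nat \<Rightarrow> location) \<Rightarrow> location"
  assumes "N \<ge> 1" and "\<alpha> \<ge> 2" and "h > 0" and "\<kappa> > 0" and "P > 0"
    and "\<And>i. i \<in> {1..N} \<Longrightarrow> r i > 0"
    and "r_max = Max (r ` {1..N})" and "r_min = Min (r ` {1..N})"
    and "\<And>i. i \<in> {1..N} \<Longrightarrow> L i \<in> A"
    and "is_arg_min (crowdsourcing_cost N r P \<kappa> h \<alpha> L) (\<lambda>q. q \<in> A) (M_OPT L)"
  shows "crowdsourcing_cost N r P \<kappa> h \<alpha> L (median_mechanism N L)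
    \<le> 2 powr (\<alpha> / 2) * real N powr (\<alpha> / 2 - 1) * (r_max / r_min)
        * crowdsourcing_cost N r P \<kappa> h \<alpha> L (M_OPT L)"
proof -
  \<comment> \<open>\<open>w\<close> collects the factors shared by all workers, leaving
    \<open>r i\<close> as the only individual weight.\<close>
  define w where "w = P * \<kappa> / (\<Sum>j\<in>{1..N}. r j)"
  define E where "E q = (\<Sum>i\<in>{1..N}. station_dist h (L i) q powr \<alpha>)" for q
  let ?C = "2 powr (\<alpha> / 2) * real N powr (\<alpha> / 2 - 1)"
  have w: "w \<ge> 0"
    using assms(4-6) unfolding w_def
    by (intro divide_nonneg_nonneg mult_nonneg_nonneg sum_nonneg) (auto intro: less_imp_le)
  have cost: "crowdsourcing_cost N r P \<kappa> h \<alpha> L q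
      = w * (\<Sum>i\<in>{1..N}. r i * station_dist h (L i) q powr \<alpha>)" for q
    by (simp add: crowdsourcing_cost_def w_def sum_distrib_left mult_ac)
  have r: "r_min \<le> r i" "r i \<le> r_max" if "i \<in> {1..N}" for i
    using that assms(7,8) by auto
  \<comment> \<open>N \<ge> 1 makes the set of rates nonempty, so the minimum is attained and
    inherits positivity.\<close>
  have "r_min \<in> r ` {1..N}"
    unfolding assms(8) using assms(1) by (intro Min_in) auto
  then have r_min: "r_min > 0"
    using assms(6) by auto
  have r_max: "r_max > 0"
    using r[of 1] r_min assms(1) by simp
  \<comment> \<open>Equalising the weights: \<open>upper\<close> is applied at the median,
    \<open>lower\<close> at the competitor.\<close>
  have upper: "(\<Sum>i\<in>{1..N}. r i * station_dist h (L i) q powr \<alpha>) \<le> r_max * E q" for q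
    unfolding E_def sum_distrib_left by (intro sum_mono mult_right_mono r) auto
  have lower: "r_min * E q \<le> (\<Sum>i\<in>{1..N}. r i * station_dist h (L i) q powr \<alpha>)" for q
    unfolding E_def sum_distrib_left by (intro sum_mono mult_right_mono r) auto
  have "crowdsourcing_cost N r P \<kappa> h \<alpha> L (median_mechanism N L)
      \<le> w * (r_max * E (median_mechanism N L))"
    unfolding cost by (intro mult_left_mono upper w)
  also have "\<dots> \<le> w * (r_max * (?C * E (M_OPT L)))"
    unfolding E_def using w r_max assms(2,3)
    by (intro mult_left_mono sum_station_dist_powr_median_le) auto
  \<comment> \<open>Inserting r_min / r_min produces the ratio and prepares the use of
    \<open>lower\<close>.\<close>
  also have "\<dots> = ?C * (r_max / r_min) * (w * (r_min * E (M_OPT L)))"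
    using r_min by simp
  also have "\<dots> \<le> ?C * (r_max / r_min) * crowdsourcing_cost N r P \<kappa> h \<alpha> L (M_OPT L)"
    unfolding cost using w r_max r_min lower by (intro mult_left_mono) auto
  finally show ?thesis .
qed

end
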